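(* The logic $\mathbf{RmbC}$ is definable within the minimal bimodal logic $\mathbf E\oplus\mathbf E$ in the following sense: for every $\Gamma\cup\{\varphi\}\subseteq For(\Sigma)$, $\Gamma\vdash_{\mathbf{RmbC}}\varphi$ if and only if $\Gamma^t\vdash_{\mathbf E\oplus\mathbf E}\varphi^t$, where $\Gamma^t=\{\psi^t:\psi\in\Gamma\}$.
   Context: Let $\Sigma=\{\wedge,\vee,\to,\neg,\circ\}$ ($\neg,\circ$ unary) and $\Sigma_{bm}=\{\wedge,\vee,\to,\sim,\square_1,\lozenge_1,\square_2,\lozenge_2\}$ ($\sim,\square_i,\lozenge_i$ unary). For a signature $\Theta$, $For(\Theta)$ is the set of formulas over $\Theta$ generated by a fixed denumerable set $\mathcal V$ of propositional variables. $\alpha\leftrightarrow\beta$ abbreviates $(\alpha\to\beta)\wedge(\beta\to\alpha)$. $\mathbf{CPL}^+$ (positive classical logic) has axiom schemas: (Ax1) $\alpha\to(\beta\to\alpha)$; (Ax2) $(\alpha\to(\beta\to\gamma))\to((\alpha\to\beta)\to(\alpha\to\gamma))$; (Ax3) $\alpha\to(\beta\to(\alpha\wedge\beta))$; (Ax4) $(\alpha\wedge\beta)\to\alpha$; (Ax5) $(\alpha\wedge\beta)\to\beta$; (Ax6) $\alpha\to(\alpha\vee\beta)$; (Ax7) $\beta\to(\alpha\vee\beta)$; (Ax8) $(\alpha\to\gamma)\to((\beta\to\gamma)\to((\alpha\vee\beta)\to\gamma))$; (Ax9) $(\alpha\to\beta)\vee\alpha$; and the rule (MP): from $\alpha$ and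 $\alpha\to\beta$ infer $\beta$. $\mathbf{RmbC}$, over $\Sigma$, is $\mathbf{CPL}^+$ plus the schemas (Ax10) $\alpha\vee\neg\alpha$ and (bc1) $\circ\alpha\to(\alpha\to(\neg\alpha\to\beta))$, and the rules $(\mathbf R_\neg)$: from $\alpha\leftrightarrow\beta$ infer $\neg\alpha\leftrightarrow\neg\beta$; $(\mathbf R_\circ)$: from $\alpha\leftrightarrow\beta$ infer $\circ\alpha\leftrightarrow\circ\beta$. $\mathbf E\oplus\mathbf E$, over $\Sigma_{bm}$, is $\mathbf{CPL}^+$ plus the schemas (PEM) $\alpha\vee{\sim}\alpha$; (exp) $\alpha\to({\sim}\alpha\to\beta)$; (AxMod$_i$) $\lozenge_i\alpha\leftrightarrow{\sim}\square_i{\sim}\alpha$ for $i=1,2$; and the rules: from $\alpha\leftrightarrow\beta$ infer $\square_i\alpha\leftrightarrow\square_i\beta$, for $i=1,2$. In both logics, $\varphi$ is a theorem ($\vdash\varphi$) if there is a finite sequence of formulas ending in $\varphi$ each of which is an instance of an axiom schema or follows from earlier formulas of the sequence by a rule; and $\Gamma\vdash\varphi$ means that either $\vdash\varphi$ or there is a finite non-empty $\{\gamma_1,\dots,\gamma_n\}\subseteq\Gamma$ with $\vdash(\gamma_1\wedge(\gamma_2\wedge(\cdots\wedge(\gamma_{n-1}\wedge\gamma_n)\cdots)))\to\varphi$. The translation $t:For(\Sigma)\to For(\Sigma_{bm})$ is: $p^t=p$ for $p\in\mathcal V$; $(\varphi\#\psi)^t=\varphi^t\#\psi^t$ for $\#\in\{\wedge,\vee,\to\}$;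 $(\neg\varphi)^t=\varphi^t\to\square_1\varphi^t$; $(\circ\varphi)^t={\sim}(\varphi^t\wedge\square_1\varphi^t)\wedge\square_2\varphi^t$. *)

theory Defs
  imports Main
begin

text \<open>Both signatures consist of the three binary connectives of positive logic plus some unary
  connectives, so \<open>'u fm\<close> is the set of formulas over the signature whose unary connectives are the
  elements of \<open>'u\<close>. The denumerable set of propositional variables is \<open>nat\<close>.\<close>

datatype 'u fm =
    Var nat
  | Conj "'u fm" "'u fm" (infixr "\<^bold>\<and>" 65)
  | Disj "'u fm" "'u fm" (infixr "\<^bold>\<or>" 60)
  | Imp "'u fm" "'u fm" (infixr "\<^bold>\<rightarrow>" 55)
  | Unary 'u "'u fm"

abbreviation Iff :: "'u fm \<Rightarrow> 'u fm \<Rightarrow> 'u fm" (infix "\<^bold>\<leftrightarrow>" 53) where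
  "\<alpha> \<^bold>\<leftrightarrow> \<beta> \<equiv> (\<alpha> \<^bold>\<rightarrow> \<beta>) \<^bold>\<and> (\<beta> \<^bold>\<rightarrow> \<alpha>)"

datatype ops = NegOp | CircOp

datatype ix = I1 | I2

datatype bm_ops = SimOp | BoxOp ix | DiaOp ix

abbreviation Neg :: "ops fm \<Rightarrow> ops fm" where "Neg \<equiv> Unary NegOp"
abbreviation Circ :: "ops fm \<Rightarrow> ops fm" where "Circ \<equiv> Unary CircOp"
abbreviation Sim :: "bm_ops fm \<Rightarrow> bm_ops fm" where "Sim \<equiv> Unary SimOp"
abbreviation Box :: "ix \<Rightarrow> bm_ops fm \<Rightarrow> bm_ops fm" where "Box i \<equiv> Unary (BoxOp i)"
abbreviation Dia :: "ix \<Rightarrow> bm_ops fm \<Rightarrow> bm_ops fm" where "Dia i \<equiv> Unary (DiaOp i)"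

text \<open>A calculus is given by a set \<open>Ax\<close> of axiom instances and a set \<open>R\<close> of rule instances
  (premises, conclusion).\<close>

definition derivation :: "'u fm set \<Rightarrow> ('u fm set \<times> 'u fm) set \<Rightarrow> 'u fm list \<Rightarrow> bool" where
  "derivation Ax R ds \<longleftrightarrow>
     (\<forall>k < length ds. ds ! k \<in> Ax \<or> (\<exists>P. (P, ds ! k) \<in> R \<and> P \<subseteq> set (take k ds)))"

definition provable :: "'u fm set \<Rightarrow> ('u fm set \<times> 'u fm) set \<Rightarrow> 'u fm \<Rightarrow> bool" where
  "provable Ax R \<phi> \<longleftrightarrow> (\<exists>ds. derivation Ax R ds \<and> ds \<noteq> [] \<and> last ds = \<phi>)"

text \<open>The value on the empty list is irrelevant.\<close>

fun big_conj :: "'u fm list \<Rightarrow> 'u fm" where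
  "big_conj [\<gamma>] = \<gamma>"
| "big_conj (\<gamma> # \<delta> # \<gamma>s) = \<gamma> \<^bold>\<and> big_conj (\<delta> # \<gamma>s)"

text \<open>The rules apply to theorems only: premises enter through the implication. Hence this is
  not derivability from the hypotheses \<open>\<Gamma>\<close> by the rules in \<open>R\<close>.\<close>

definition entails ::
  "'u fm set \<Rightarrow> ('u fm set \<times> 'u fm) set \<Rightarrow> 'u fm set \<Rightarrow> 'u fm \<Rightarrow> bool" where
  "entails Ax R \<Gamma> \<phi> \<longleftrightarrow> provable Ax R \<phi> \<or>
     (\<exists>\<gamma>s. \<gamma>s \<noteq> [] \<and> set \<gamma>s \<subseteq> \<Gamma> \<and> provable Ax R (big_conj \<gamma>s \<^bold>\<rightarrow> \<phi>))"

inductive_set CPL_axioms :: "'u fm set" where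
  Ax1: "\<alpha> \<^bold>\<rightarrow> (\<beta> \<^bold>\<rightarrow> \<alpha>) \<in> CPL_axioms"
| Ax2: "(\<alpha> \<^bold>\<rightarrow> (\<beta> \<^bold>\<rightarrow> \<gamma>)) \<^bold>\<rightarrow> ((\<alpha> \<^bold>\<rightarrow> \<beta>) \<^bold>\<rightarrow> (\<alpha> \<^bold>\<rightarrow> \<gamma>)) \<in> CPL_axioms"
| Ax3: "\<alpha> \<^bold>\<rightarrow> (\<beta> \<^bold>\<rightarrow> (\<alpha> \<^bold>\<and> \<beta>)) \<in> CPL_axioms"
| Ax4: "(\<alpha> \<^bold>\<and> \<beta>) \<^bold>\<rightarrow> \<alpha> \<in> CPL_axioms"
| Ax5: "(\<alpha> \<^bold>\<and> \<beta>) \<^bold>\<rightarrow> \<beta> \<in> CPL_axioms"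
| Ax6: "\<alpha> \<^bold>\<rightarrow> (\<alpha> \<^bold>\<or> \<beta>) \<in> CPL_axioms"
| Ax7: "\<beta> \<^bold>\<rightarrow> (\<alpha> \<^bold>\<or> \<beta>) \<in> CPL_axioms"
| Ax8: "(\<alpha> \<^bold>\<rightarrow> \<gamma>) \<^bold>\<rightarrow> ((\<beta> \<^bold>\<rightarrow> \<gamma>) \<^bold>\<rightarrow> ((\<alpha> \<^bold>\<or> \<beta>) \<^bold>\<rightarrow> \<gamma>)) \<in> CPL_axioms"
| Ax9: "(\<alpha> \<^bold>\<rightarrow> \<beta>) \<^bold>\<or> \<alpha> \<in> CPL_axioms"

inductive_set CPL_rules :: "('u fm set \<times> 'u fm) set" where
  MP: "({\<alpha>, \<alpha> \<^bold>\<rightarrow> \<beta>}, \<beta>) \<in> CPL_rules"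

inductive_set RmbC_axioms :: "ops fm set" where
  CPL: "\<phi> \<in> CPL_axioms \<Longrightarrow> \<phi> \<in> RmbC_axioms"
| Ax10: "\<alpha> \<^bold>\<or> Neg \<alpha> \<in> RmbC_axioms"
| bc1: "Circ \<alpha> \<^bold>\<rightarrow> (\<alpha> \<^bold>\<rightarrow> (Neg \<alpha> \<^bold>\<rightarrow> \<beta>)) \<in> RmbC_axioms"

inductive_set RmbC_rules :: "(ops fm set \<times> ops fm) set" where
  CPL: "r \<in> CPL_rules \<Longrightarrow> r \<in> RmbC_rules"
| R_Neg: "({\<alpha> \<^bold>\<leftrightarrow> \<beta>}, Neg \<alpha> \<^bold>\<leftrightarrow> Neg \<beta>) \<in> RmbC_rules"
| R_Circ: "({\<alpha> \<^bold>\<leftrightarrow> \<beta>}, Circ \<alpha> \<^bold>\<leftrightarrow> Circ \<beta>) \<in> RmbC_rules"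

abbreviation RmbC_entails :: "ops fm set \<Rightarrow> ops fm \<Rightarrow> bool" (infix "\<turnstile>\<^bsub>RmbC\<^esub>" 50) where
  "\<Gamma> \<turnstile>\<^bsub>RmbC\<^esub> \<phi> \<equiv> entails RmbC_axioms RmbC_rules \<Gamma> \<phi>"

inductive_set EE_axioms :: "bm_ops fm set" where
  CPL: "\<phi> \<in> CPL_axioms \<Longrightarrow> \<phi> \<in> EE_axioms"
| PEM: "\<alpha> \<^bold>\<or> Sim \<alpha> \<in> EE_axioms"
| exp: "\<alpha> \<^bold>\<rightarrow> (Sim \<alpha> \<^bold>\<rightarrow> \<beta>) \<in> EE_axioms"
| AxMod: "Dia i \<alpha> \<^bold>\<leftrightarrow> Sim (Box i (Sim \<alpha>)) \<in> EE_axioms"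

inductive_set EE_rules :: "(bm_ops fm set \<times> bm_ops fm) set" where
  CPL: "r \<in> CPL_rules \<Longrightarrow> r \<in> EE_rules"
| R_Box: "({\<alpha> \<^bold>\<leftrightarrow> \<beta>}, Box i \<alpha> \<^bold>\<leftrightarrow> Box i \<beta>) \<in> EE_rules"

abbreviation EE_entails :: "bm_ops fm set \<Rightarrow> bm_ops fm \<Rightarrow> bool" (infix "\<turnstile>\<^bsub>EE\<^esub>" 50) where
  "\<Gamma> \<turnstile>\<^bsub>EE\<^esub> \<phi> \<equiv> entails EE_axioms EE_rules \<Gamma> \<phi>"

fun trans_fm :: "ops fm \<Rightarrow> bm_ops fm" where
  "trans_fm (Var p) = Var p"
| "trans_fm (\<phi> \<^bold>\<and> \<psi>) = trans_fm \<phi> \<^bold>\<and> trans_fm \<psi>"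
| "trans_fm (\<phi> \<^bold>\<or> \<psi>) = trans_fm \<phi> \<^bold>\<or> trans_fm \<psi>"
| "trans_fm (\<phi> \<^bold>\<rightarrow> \<psi>) = trans_fm \<phi> \<^bold>\<rightarrow> trans_fm \<psi>"
| "trans_fm (Neg \<phi>) = trans_fm \<phi> \<^bold>\<rightarrow> Box I1 (trans_fm \<phi>)"
| "trans_fm (Circ \<phi>) =
     Sim (trans_fm \<phi> \<^bold>\<and> Box I1 (trans_fm \<phi>)) \<^bold>\<and> Box I2 (trans_fm \<phi>)"

end

theory Submission
  imports Defs
begin

text \<open>The translation has an inverse up to provable equivalence. In \<open>RmbC\<close> the formula
  \<open>p \<and> \<not>p \<and> \<circ>p\<close> is a falsum, which yields a classical negation; read \<open>\<box>\<^sub>1\<close> as \<open>\<not>\<close> and \<open>\<box>\<^sub>2\<close> as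
  \<open>\<circ>\<close>. Then \<open>\<alpha> \<rightarrow> \<box>\<^sub>1\<alpha>\<close> becomes \<open>\<alpha> \<rightarrow> \<not>\<alpha>\<close>, which is equivalent to \<open>\<not>\<alpha>\<close> by excluded middle, and
  \<open>\<sim>(\<alpha> \<and> \<box>\<^sub>1\<alpha>) \<and> \<box>\<^sub>2\<alpha>\<close> becomes \<open>\<sim>(\<alpha> \<and> \<not>\<alpha>) \<and> \<circ>\<alpha>\<close>, which is equivalent to \<open>\<circ>\<alpha>\<close> by (bc1).
  Both translations preserve theorems, so no neighbourhood semantics is needed.\<close>

section \<open>Derivations as lists, and induction on theorems\<close>

lemma derivation_append:
  assumes "derivation Ax R xs" "derivation Ax R ys"
  shows "derivation Ax R (xs @ ys)"
  unfolding derivation_def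
proof (intro allI impI)
  fix k assume k: "k < length (xs @ ys)"
  show "(xs @ ys) ! k \<in> Ax \<or> (\<exists>P. (P, (xs @ ys) ! k) \<in> R \<and> P \<subseteq> set (take k (xs @ ys)))"
  proof (cases "k < length xs")
    case True
    then show ?thesis
      using assms(1) by (simp add: derivation_def nth_append)
  next
    case False
    with k have "k - length xs < length ys" by simp
    then have "ys ! (k - length xs) \<in> Ax \<or>
        (\<exists>P. (P, ys ! (k - length xs)) \<in> R \<and> P \<subseteq> set (take (k - length xs) ys))"
      using assms(2) by (simp add: derivation_def)
    with False show ?thesis
      by (auto simp: nth_append)
  qed
qed

lemma derivation_snoc:
  assumes "derivation Ax R xs" "\<phi> \<in> Ax \<or> (\<exists>P. (P, \<phi>) \<in> R \<and> P \<subseteq> set xs)"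
  shows "derivation Ax R (xs @ [\<phi>])"
  using assms by (auto simp: derivation_def nth_append less_Suc_eq)

lemma provable_axiom: "\<phi> \<in> Ax \<Longrightarrow> provable Ax R \<phi>"
  unfolding provable_def
  by (rule exI[of _ "[\<phi>]"]) (simp add: derivation_def)

text \<open>Since \<open>P\<close> is finite, derivations of its members can be concatenated into
  one list containing all of \<open>P\<close>; the conclusion is then appended.\<close>

lemma provable_rule:
  assumes "(P, \<phi>) \<in> R" "finite P" "\<And>\<psi>. \<psi> \<in> P \<Longrightarrow> provable Ax R \<psi>"
  shows "provable Ax R \<phi>"
proof -
  have "\<exists>ds. derivation Ax R ds \<and> P \<subseteq> set ds"
    using assms(2,3)
  proof (induction P)
    case empty
    show ?case by (rule exI[of _ "[]"]) (simp add: derivation_def)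
  next
    case (insert \<psi> P)
    then obtain ds where ds: "derivation Ax R ds" "P \<subseteq> set ds" by auto
    from insert.prems obtain es where es: "derivation Ax R es" "es \<noteq> []" "last es = \<psi>"
      unfolding provable_def by auto
    have "insert \<psi> P \<subseteq> set (ds @ es)"
      using ds(2) es(2,3) last_in_set by fastforce
    with derivation_append[OF ds(1) es(1)] show ?case by blast
  qed
  then obtain ds where ds: "derivation Ax R ds" "P \<subseteq> set ds" by auto
  have "derivation Ax R (ds @ [\<phi>])"
    using derivation_snoc[OF ds(1)] ds(2) assms(1) by blast
  then show ?thesis
    unfolding provable_def by (intro exI[of _ "ds @ [\<phi>]"]) simp
qed

text \<open>Strong induction on the position in a derivation: the premises of a rule stand strictly
  earlier. This lets \<open>provable\<close> be used like an inductive predicate.\<close>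

lemma provable_induct [consumes 1, case_names axiom rule]:
  assumes "provable Ax R \<phi>"
    and ax: "\<And>\<psi>. \<psi> \<in> Ax \<Longrightarrow> Q \<psi>"
    and rule: "\<And>P \<psi>. (P, \<psi>) \<in> R \<Longrightarrow> (\<And>\<chi>. \<chi> \<in> P \<Longrightarrow> Q \<chi>) \<Longrightarrow> Q \<psi>"
  shows "Q \<phi>"
proof -
  obtain ds where ds: "derivation Ax R ds" "ds \<noteq> []" "last ds = \<phi>"
    using assms(1) by (auto simp: provable_def)
  have "k < length ds \<Longrightarrow> Q (ds ! k)" for k
  proof (induction k rule: less_induct)
    case (less k)
    from ds(1) less.prems consider "ds ! k \<in> Ax"
      | P where "(P, ds ! k) \<in> R" "P \<subseteq> set (take k ds)"
      unfolding derivation_def by blast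
    then show ?case
    proof cases
      case 1
      then show ?thesis by (rule ax)
    next
      case 2
      have "Q \<chi>" if "\<chi> \<in> P" for \<chi>
      proof -
        from that 2(2) obtain j where "j < k" "ds ! j = \<chi>"
          using less.prems by (auto simp: in_set_conv_nth subset_iff)
        with less show ?thesis by auto
      qed
      with 2(1) show ?thesis by (rule rule)
    qed
  qed
  with ds(2,3) show ?thesis by (auto simp: last_conv_nth)
qed

subsection \<open>Completeness of positive logic over an arbitrary theory\<close>

text \<open>The congruence rules are left out on purpose: adding an assumption to the theorems of
  either calculus need not preserve closure under them.\<close>

definition cpl_theory :: "'u fm set \<Rightarrow> bool" where
  "cpl_theory T \<longleftrightarrow> CPL_axioms \<subseteq> T \<and> (\<forall>\<alpha> \<beta>. \<alpha> \<in> T \<longrightarrow> \<alpha> \<^bold>\<rightarrow> \<beta> \<in> T \<longrightarrow> \<beta> \<in> T)"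

lemma cpl_theory_axiom: "cpl_theory T \<Longrightarrow> \<phi> \<in> CPL_axioms \<Longrightarrow> \<phi> \<in> T"
  by (auto simp: cpl_theory_def)

lemma cpl_theory_mp: "cpl_theory T \<Longrightarrow> \<alpha> \<^bold>\<rightarrow> \<beta> \<in> T \<Longrightarrow> \<alpha> \<in> T \<Longrightarrow> \<beta> \<in> T"
  unfolding cpl_theory_def by blast

text \<open>The deduction theorem in terms of theories: this set is the least theory containing
  \<open>T\<close> and \<alpha>. Ax1 gives the inclusion of \<open>T\<close>, Ax2 the closure under
  modus ponens.\<close>

lemma cpl_theory_extend:
  assumes T: "cpl_theory T"
  shows "cpl_theory {\<beta>. \<alpha> \<^bold>\<rightarrow> \<beta> \<in> T}" "T \<subseteq> {\<beta>. \<alpha> \<^bold>\<rightarrow> \<beta> \<in> T}" "\<alpha> \<^bold>\<rightarrow> \<alpha> \<in> T"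
proof -
  note mp = cpl_theory_mp[OF T] and ax = CPL_axioms.intros[THEN cpl_theory_axiom[OF T]]
  have weaken: "\<alpha> \<^bold>\<rightarrow> \<beta> \<in> T" if "\<beta> \<in> T" for \<beta>
    by (rule mp[OF ax(1) that])
  then show "T \<subseteq> {\<beta>. \<alpha> \<^bold>\<rightarrow> \<beta> \<in> T}" by (auto simp only:)
  show "cpl_theory {\<beta>. \<alpha> \<^bold>\<rightarrow> \<beta> \<in> T}"
    unfolding cpl_theory_def subset_iff mem_Collect_eq
  proof (intro conjI allI impI)
    fix \<beta> :: "'a fm" assume "\<beta> \<in> CPL_axioms"
    then show "\<alpha> \<^bold>\<rightarrow> \<beta> \<in> T"
      by (intro weaken cpl_theory_axiom[OF T])
  next
    fix \<beta> \<gamma> assume "\<alpha> \<^bold>\<rightarrow> \<beta> \<in> T" "\<alpha> \<^bold>\<rightarrow> (\<beta> \<^bold>\<rightarrow> \<gamma>) \<in> T"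
    then show "\<alpha> \<^bold>\<rightarrow> \<gamma> \<in> T"
      using mp[OF mp[OF ax(2)]] by metis
  qed
  show "\<alpha> \<^bold>\<rightarrow> \<alpha> \<in> T"
    by (rule mp[OF mp[OF ax(2)[of _ "\<alpha> \<^bold>\<rightarrow> \<alpha>"] ax(1)] ax(1)])
qed

lemma cpl_theory_Union_chain:
  assumes "subset.chain {T. cpl_theory T \<and> \<phi> \<notin> T} C" "C \<noteq> {}"
  shows "cpl_theory (\<Union>C)"
  unfolding cpl_theory_def
proof (intro conjI allI impI)
  have C: "\<And>T. T \<in> C \<Longrightarrow> cpl_theory T"
    and lin: "\<And>S T. S \<in> C \<Longrightarrow> T \<in> C \<Longrightarrow> S \<subseteq> T \<or> T \<subseteq> S"
    using assms(1) by (auto simp: subset_chain_def)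
  show "CPL_axioms \<subseteq> \<Union>C"
    using C assms(2) by (auto simp: cpl_theory_def)
  fix \<alpha> \<beta> assume "\<alpha> \<in> \<Union>C" "\<alpha> \<^bold>\<rightarrow> \<beta> \<in> \<Union>C"
  then obtain S S' where "S \<in> C" "\<alpha> \<in> S" "S' \<in> C" "\<alpha> \<^bold>\<rightarrow> \<beta> \<in> S'" by blast
  with lin[of S S'] obtain U where U: "U \<in> C" "\<alpha> \<in> U" "\<alpha> \<^bold>\<rightarrow> \<beta> \<in> U" by auto
  from cpl_theory_mp[OF C[OF U(1)] U(3,2)] U(1) show "\<beta> \<in> \<Union>C" by blast
qed

text \<open>Zorn's lemma for the theories that extend \<open>T\<close> and omit \<phi>. Positive
  logic has no falsum, so omitting one fixed formula takes the place of consistency.\<close>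

lemma maximal_cpl_theory:
  assumes "cpl_theory T" "\<phi> \<notin> T"
  obtains M where "cpl_theory M" "T \<subseteq> M" "\<phi> \<notin> M"
    "\<And>S. cpl_theory S \<Longrightarrow> M \<subseteq> S \<Longrightarrow> \<phi> \<notin> S \<Longrightarrow> S = M"
proof -
  let ?A = "{S. cpl_theory S \<and> \<phi> \<notin> S}"
  have "\<exists>M\<in>{S \<in> ?A. T \<subseteq> S}. \<forall>S\<in>{S \<in> ?A. T \<subseteq> S}. M \<subseteq> S \<longrightarrow> S = M"
  proof (rule subset_Zorn_nonempty)
    show "{S \<in> ?A. T \<subseteq> S} \<noteq> {}" using assms by auto
  next
    fix C assume C: "C \<noteq> {}" "subset.chain {S \<in> ?A. T \<subseteq> S} C"
    then have "subset.chain ?A C" by (auto simp: subset_chain_def)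
    then have "cpl_theory (\<Union>C)" using C(1) by (rule cpl_theory_Union_chain)
    moreover have "T \<subseteq> S \<and> \<phi> \<notin> S" if "S \<in> C" for S
      using C(2) that by (auto simp: subset_chain_def)
    ultimately show "\<Union>C \<in> {S \<in> ?A. T \<subseteq> S}"
      using C(1) by blast
  qed
  then obtain M where "M \<in> {S \<in> ?A. T \<subseteq> S}"
    and max: "\<forall>S\<in>{S \<in> ?A. T \<subseteq> S}. M \<subseteq> S \<longrightarrow> S = M"
    by (rule bexE)
  then have M: "cpl_theory M" "T \<subseteq> M" "\<phi> \<notin> M" by simp_all
  show ?thesis
  proof (rule that[OF M])
    fix S assume S: "cpl_theory S" "M \<subseteq> S" "\<phi> \<notin> S"
    with M(2) have "S \<in> {S \<in> ?A. T \<subseteq> S}" by simp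
    with max S(2) show "S = M" by (simp only:)
  qed
qed

text \<open>Formulas \<open>Unary u \<alpha>\<close> are atoms here, and the constantly true valuation is excluded.\<close>

definition valuation :: "('u fm \<Rightarrow> bool) \<Rightarrow> bool" where
  "valuation v \<longleftrightarrow> (\<forall>\<alpha> \<beta>. v (\<alpha> \<^bold>\<and> \<beta>) = (v \<alpha> \<and> v \<beta>) \<and> v (\<alpha> \<^bold>\<or> \<beta>) = (v \<alpha> \<or> v \<beta>) \<and>
     v (\<alpha> \<^bold>\<rightarrow> \<beta>) = (v \<alpha> \<longrightarrow> v \<beta>)) \<and> (\<exists>\<alpha>. \<not> v \<alpha>)"

lemma valuation_simps [simp]:
  assumes "valuation v"
  shows "v (\<alpha> \<^bold>\<and> \<beta>) = (v \<alpha> \<and> v \<beta>)" "v (\<alpha> \<^bold>\<or> \<beta>) = (v \<alpha> \<or> v \<beta>)"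
    "v (\<alpha> \<^bold>\<rightarrow> \<beta>) = (v \<alpha> \<longrightarrow> v \<beta>)"
  using assms by (auto simp: valuation_def)

lemma valuation_nontrivial: "valuation v \<Longrightarrow> \<exists>\<alpha>. \<not> v \<alpha>"
  unfolding valuation_def by (rule conjunct2)

text \<open>The omitted formula \<phi> acts as a falsum: whatever lies outside \<open>M\<close>
  implies it. Ax8 then makes \<open>M\<close> prime, and \<phi> witnesses that the valuation is not
  constantly true.\<close>

lemma maximal_cpl_theory_valuation:
  assumes M: "cpl_theory M" "\<phi> \<notin> M"
    and max: "\<And>S. cpl_theory S \<Longrightarrow> M \<subseteq> S \<Longrightarrow> \<phi> \<notin> S \<Longrightarrow> S = M"
  shows "valuation (\<lambda>\<alpha>. \<alpha> \<in> M)"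
proof -
  note mp = cpl_theory_mp[OF M(1)] and ax = CPL_axioms.intros[THEN cpl_theory_axiom[OF M(1)]]
  \<comment> \<open>Otherwise the extension of \<open>M\<close> by \<alpha> would still omit \<phi>,
    hence equal \<open>M\<close> by maximality, although it contains \<alpha>.\<close>
  have imp_phi: "\<alpha> \<^bold>\<rightarrow> \<phi> \<in> M" if "\<alpha> \<notin> M" for \<alpha>
  proof (rule ccontr)
    assume "\<alpha> \<^bold>\<rightarrow> \<phi> \<notin> M"
    then have "{\<beta>. \<alpha> \<^bold>\<rightarrow> \<beta> \<in> M} = M"
      using cpl_theory_extend(1,2)[OF M(1), of \<alpha>] 
      by (intro max) simp_all
    with cpl_theory_extend(3)[OF M(1), of \<alpha>] that show False by blast
  qed
  have disj: "\<alpha> \<in> M \<or> \<beta> \<in> M" if "\<alpha> \<^bold>\<or> \<beta> \<in> M" for \<alpha> \<beta>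
  proof (rule ccontr)
    assume "\<not> (\<alpha> \<in> M \<or> \<beta> \<in> M)"
    then have "\<alpha> \<^bold>\<rightarrow> \<phi> \<in> M" "\<beta> \<^bold>\<rightarrow> \<phi> \<in> M" by (simp_all add: imp_phi)
    from mp[OF mp[OF mp[OF ax(8) this(1)] this(2)] that] M(2) show False by blast
  qed
  have "\<alpha> \<^bold>\<and> \<beta> \<in> M \<longleftrightarrow> \<alpha> \<in> M \<and> \<beta> \<in> M" for \<alpha> \<beta>
    using mp[OF mp[OF ax(3)[of \<alpha> \<beta>]]] mp[OF ax(4)[of \<alpha> \<beta>]] mp[OF ax(5)[of \<alpha> \<beta>]] by blast
  moreover have "\<alpha> \<^bold>\<or> \<beta> \<in> M \<longleftrightarrow> \<alpha> \<in> M \<or> \<beta> \<in> M" for \<alpha> \<beta>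
    using disj[of \<alpha> \<beta>] mp[OF ax(6)[of \<alpha> \<beta>]] mp[OF ax(7)[of \<beta> \<alpha>]] by blast
  \<comment> \<open>Here the logic becomes classical: by Ax9 and primeness either the implication or
    \<alpha> is in \<open>M\<close>. In the latter case \<beta> is in \<open>M\<close> too, and Ax1
    yields the implication.\<close>
  moreover have "\<alpha> \<^bold>\<rightarrow> \<beta> \<in> M \<longleftrightarrow> (\<alpha> \<in> M \<longrightarrow> \<beta> \<in> M)" for \<alpha> \<beta>
    using disj[OF ax(9)[of \<alpha> \<beta>]] mp[of \<alpha> \<beta>] mp[OF ax(1)[of \<beta> \<alpha>]] by blast
  ultimately show ?thesis
    using M(2) by (auto simp: valuation_def)
qed

text \<open>Membership in a maximal theory that extends \<open>T\<close> and omits \<phi> would be a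
  countermodel. Applied to the theorems of a calculus, this turns provability into a truth-table
  check, with unary formulas as atoms constrained only by the theorems.\<close>

theorem cpl_theory_complete:
  assumes "cpl_theory T"
    and "\<And>v. valuation v \<Longrightarrow> (\<And>\<theta>. \<theta> \<in> T \<Longrightarrow> v \<theta>) \<Longrightarrow> v \<phi>"
  shows "\<phi> \<in> T"
proof (rule ccontr)
  assume "\<phi> \<notin> T"
  with assms(1) obtain M where M: "cpl_theory M" "T \<subseteq> M" "\<phi> \<notin> M"
    "\<And>S. cpl_theory S \<Longrightarrow> M \<subseteq> S \<Longrightarrow> \<phi> \<notin> S \<Longrightarrow> S = M"
    by (rule maximal_cpl_theory) (rule that)
  have "valuation (\<lambda>\<alpha>. \<alpha> \<in> M)"
    using M(1,3,4) by (rule maximal_cpl_theory_valuation)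
  then have "\<phi> \<in> M"
    by (rule assms(2)) (rule subsetD[OF M(2)])
  with M(3) show False by contradiction
qed

lemma cpl_theory_provable:
  assumes "CPL_axioms \<subseteq> Ax" "CPL_rules \<subseteq> R"
  shows "cpl_theory {\<phi>. provable Ax R \<phi>}"
  unfolding cpl_theory_def
proof (intro conjI allI impI)
  show "CPL_axioms \<subseteq> {\<phi>. provable Ax R \<phi>}"
    using assms(1) by (auto intro: provable_axiom)
  fix \<alpha> \<beta> assume "\<alpha> \<in> {\<phi>. provable Ax R \<phi>}" "\<alpha> \<^bold>\<rightarrow> \<beta> \<in> {\<phi>. provable Ax R \<phi>}"
  then show "\<beta> \<in> {\<phi>. provable Ax R \<phi>}"
    using provable_rule[of "{\<alpha>, \<alpha> \<^bold>\<rightarrow> \<beta>}" \<beta> R Ax] assms(2) CPL_rules.MP[of \<alpha> \<beta>] by auto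
qed

subsection \<open>The two calculi\<close>

abbreviation RmbC_provable :: "ops fm \<Rightarrow> bool" where
  "RmbC_provable \<equiv> provable RmbC_axioms RmbC_rules"

abbreviation EE_provable :: "bm_ops fm \<Rightarrow> bool" where
  "EE_provable \<equiv> provable EE_axioms EE_rules"

lemma RmbC_theory: "cpl_theory {\<phi>. RmbC_provable \<phi>}"
  by (rule cpl_theory_provable) (auto intro: RmbC_axioms.intros RmbC_rules.intros)

lemma RmbC_complete:
  assumes "\<And>v. valuation v \<Longrightarrow> (\<And>\<theta>. RmbC_provable \<theta> \<Longrightarrow> v \<theta>) \<Longrightarrow> v \<phi>"
  shows "RmbC_provable \<phi>"
  by (rule cpl_theory_complete[OF RmbC_theory, unfolded mem_Collect_eq, OF assms])

lemma EE_theory: "cpl_theory {\<phi>. EE_provable \<phi>}"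
  by (rule cpl_theory_provable) (auto intro: EE_axioms.intros EE_rules.intros)

lemma EE_complete:
  assumes "\<And>v. valuation v \<Longrightarrow> (\<And>\<theta>. EE_provable \<theta> \<Longrightarrow> v \<theta>) \<Longrightarrow> v \<phi>"
  shows "EE_provable \<phi>"
  by (rule cpl_theory_complete[OF EE_theory, unfolded mem_Collect_eq, OF assms])

lemma RmbC_valuation_Neg:
  assumes "valuation v" "\<And>\<theta>. RmbC_provable \<theta> \<Longrightarrow> v \<theta>"
  shows "v \<alpha> \<or> v (Neg \<alpha>)"
  using assms(2)[OF provable_axiom[OF RmbC_axioms.Ax10[of \<alpha>]]] assms(1) by simp

text \<open>Some formula is false under \<open>v\<close>; taken as the final consequent of (bc1), it
  forces one of the three antecedents to be false.\<close>

lemma RmbC_valuation_Circ: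
  assumes "valuation v" "\<And>\<theta>. RmbC_provable \<theta> \<Longrightarrow> v \<theta>"
  shows "\<not> (v (Circ \<alpha>) \<and> v \<alpha> \<and> v (Neg \<alpha>))"
proof -
  obtain \<beta> where "\<not> v \<beta>" using valuation_nontrivial[OF assms(1)] by blast
  with assms(2)[OF provable_axiom[OF RmbC_axioms.bc1[of \<alpha> \<beta>]]] assms(1) show ?thesis by simp
qed

text \<open>(PEM) gives one direction; (exp) with a false consequent gives the other.\<close>

lemma EE_valuation_Sim:
  assumes "valuation v" "\<And>\<theta>. EE_provable \<theta> \<Longrightarrow> v \<theta>"
  shows "v (Sim \<alpha>) \<longleftrightarrow> \<not> v \<alpha>"
proof -
  obtain \<beta> where "\<not> v \<beta>" using valuation_nontrivial[OF assms(1)] by blast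
  with assms(2)[OF provable_axiom[OF EE_axioms.exp[of \<alpha> \<beta>]]]
    assms(2)[OF provable_axiom[OF EE_axioms.PEM[of \<alpha>]]] assms(1)
  show ?thesis by auto
qed

lemma RmbC_congruence:
  assumes "RmbC_provable (\<alpha> \<^bold>\<leftrightarrow> \<beta>)"
  shows "RmbC_provable (Unary u \<alpha> \<^bold>\<leftrightarrow> Unary u \<beta>)"
  using assms provable_rule[OF RmbC_rules.R_Neg[of \<alpha> \<beta>], of RmbC_axioms]
    provable_rule[OF RmbC_rules.R_Circ[of \<alpha> \<beta>], of RmbC_axioms]
  by (cases u) simp_all

lemma EE_congruence:
  "EE_provable (\<alpha> \<^bold>\<leftrightarrow> \<beta>) \<Longrightarrow> EE_provable (Box i \<alpha> \<^bold>\<leftrightarrow> Box i \<beta>)"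
  using provable_rule[OF EE_rules.R_Box[of \<alpha> \<beta> i], of EE_axioms] by simp

subsection \<open>The translation and its inverse\<close>

lemma trans_fm_CPL: "\<phi> \<in> CPL_axioms \<Longrightarrow> trans_fm \<phi> \<in> CPL_axioms"
  by (induction rule: CPL_axioms.induct) (auto intro: CPL_axioms.intros)

text \<open>With a for the translation of \<alpha>, Ax10 becomes the tautology
  \<open>a or (a implies Box I1 a)\<close>. In (bc1), the assumptions a and
  \<open>a implies Box I1 a\<close> contradict the \<open>Sim\<close> conjunct. The unary rules
  reduce to congruence for the boxes.\<close>

lemma EE_provable_trans_fm:
  assumes "RmbC_provable \<phi>"
  shows "EE_provable (trans_fm \<phi>)"
  using assms
proof (induction rule: provable_induct)
  case (axiom \<psi>)
  then show ?case
  proof cases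
    case CPL
    then show ?thesis
      by (intro provable_axiom EE_axioms.CPL trans_fm_CPL)
  next
    case (Ax10 \<alpha>)
    show ?thesis
      unfolding Ax10 by (rule EE_complete) simp
  next
    case (bc1 \<alpha> \<beta>)
    show ?thesis
      unfolding bc1
    proof (rule EE_complete)
      fix v :: "bm_ops fm \<Rightarrow> bool"
      assume v: "valuation v" "\<And>\<theta>. EE_provable \<theta> \<Longrightarrow> v \<theta>"
      show "v (trans_fm (Circ \<alpha> \<^bold>\<rightarrow> (\<alpha> \<^bold>\<rightarrow> (Neg \<alpha> \<^bold>\<rightarrow> \<beta>))))"
        using v(1) EE_valuation_Sim[OF v] by auto
    qed
  qed
next
  case (rule P \<psi>)
  from rule.hyps show ?case
  proof cases
    case CPL
    then obtain \<alpha> where "P = {\<alpha>, \<alpha> \<^bold>\<rightarrow> \<psi>}"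
      by (auto elim: CPL_rules.cases)
    with rule.IH[of \<alpha>] rule.IH[of "\<alpha> \<^bold>\<rightarrow> \<psi>"]
    have prem: "EE_provable (trans_fm \<alpha>)" "EE_provable (trans_fm \<alpha> \<^bold>\<rightarrow> trans_fm \<psi>)"
      by simp_all
    from cpl_theory_mp[OF EE_theory] prem show ?thesis by blast
  next
    case (R_Neg \<alpha> \<beta>)
    let ?a = "trans_fm \<alpha>" and ?b = "trans_fm \<beta>"
    from R_Neg rule.IH have prem: "EE_provable (?a \<^bold>\<leftrightarrow> ?b)" by simp
    show ?thesis
    proof (rule EE_complete)
      fix v :: "bm_ops fm \<Rightarrow> bool"
      assume v: "valuation v" "\<And>\<theta>. EE_provable \<theta> \<Longrightarrow> v \<theta>"
      show "v (trans_fm \<psi>)"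
        using v(2)[OF prem] v(2)[OF EE_congruence[OF prem, of I1]] v(1) R_Neg by auto
    qed
  next
    case (R_Circ \<alpha> \<beta>)
    let ?a = "trans_fm \<alpha>" and ?b = "trans_fm \<beta>"
    from R_Circ rule.IH have prem: "EE_provable (?a \<^bold>\<leftrightarrow> ?b)" by simp
    show ?thesis
    proof (rule EE_complete)
      fix v :: "bm_ops fm \<Rightarrow> bool"
      assume v: "valuation v" "\<And>\<theta>. EE_provable \<theta> \<Longrightarrow> v \<theta>"
      show "v (trans_fm \<psi>)"
        \<comment> \<open>Both boxes occur in the translation of \<open>Circ\<close>, so congruence
          is required for each.\<close>
        using v(2)[OF prem] v(2)[OF EE_congruence[OF prem, of I1]]
          v(2)[OF EE_congruence[OF prem, of I2]] v(1) R_Circ EE_valuation_Sim[OF v] by auto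
    qed
  qed
qed

section \<open>The inverse translation\<close>

definition falsum :: "ops fm" where
  "falsum = Var 0 \<^bold>\<and> Neg (Var 0) \<^bold>\<and> Circ (Var 0)"

fun box_op :: "ix \<Rightarrow> ops" where
  "box_op I1 = NegOp"
| "box_op I2 = CircOp"

text \<open>The clause for \<open>Dia\<close> is the image of
  \<open>Sim (Box i (Sim \<phi>))\<close> written out, so the two sides of (AxMod) have literally
  the same image.\<close>

fun back_fm :: "bm_ops fm \<Rightarrow> ops fm" where
  "back_fm (Var p) = Var p"
| "back_fm (\<phi> \<^bold>\<and> \<psi>) = back_fm \<phi> \<^bold>\<and> back_fm \<psi>"
| "back_fm (\<phi> \<^bold>\<or> \<psi>) = back_fm \<phi> \<^bold>\<or> back_fm \<psi>"
| "back_fm (\<phi> \<^bold>\<rightarrow> \<psi>) = back_fm \<phi> \<^bold>\<rightarrow> back_fm \<psi>"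
| "back_fm (Sim \<phi>) = back_fm \<phi> \<^bold>\<rightarrow> falsum"
| "back_fm (Box i \<phi>) = Unary (box_op i) (back_fm \<phi>)"
| "back_fm (Dia i \<phi>) = Unary (box_op i) (back_fm \<phi> \<^bold>\<rightarrow> falsum) \<^bold>\<rightarrow> falsum"

lemma RmbC_valuation_falsum:
  assumes "valuation v" "\<And>\<theta>. RmbC_provable \<theta> \<Longrightarrow> v \<theta>"
  shows "\<not> v falsum"
  using RmbC_valuation_Circ[OF assms, of "Var 0"] assms(1) by (auto simp: falsum_def)

lemma back_fm_CPL: "\<phi> \<in> CPL_axioms \<Longrightarrow> back_fm \<phi> \<in> CPL_axioms"
  by (induction rule: CPL_axioms.induct) (auto intro: CPL_axioms.intros)

text \<open>Once \<open>falsum\<close> is false, the images of the axioms for \<open>Sim\<close> and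
  \<open>Dia\<close> hold truth-functionally. The rule for \<open>Box i\<close> turns into
  \<open>R_Neg\<close> or \<open>R_Circ\<close>.\<close>

lemma RmbC_provable_back_fm:
  assumes "EE_provable \<phi>"
  shows "RmbC_provable (back_fm \<phi>)"
  using assms
proof (induction rule: provable_induct)
  case (axiom \<psi>)
  show ?case
  proof (cases "\<psi> \<in> CPL_axioms")
    case True
    then show ?thesis
      by (intro provable_axiom RmbC_axioms.CPL back_fm_CPL)
  next
    case False
    show ?thesis
    proof (rule RmbC_complete)
      fix v :: "ops fm \<Rightarrow> bool"
      assume v: "valuation v" "\<And>\<theta>. RmbC_provable \<theta> \<Longrightarrow> v \<theta>"
      from axiom False show "v (back_fm \<psi>)"
        using v(1) RmbC_valuation_falsum[OF v] by cases auto
    qed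
  qed
next
  case (rule P \<psi>)
  from rule.hyps show ?case
  proof cases
    case CPL
    then obtain \<alpha> where "P = {\<alpha>, \<alpha> \<^bold>\<rightarrow> \<psi>}"
      by (auto elim: CPL_rules.cases)
    with rule.IH[of \<alpha>] rule.IH[of "\<alpha> \<^bold>\<rightarrow> \<psi>"]
    have prem: "RmbC_provable (back_fm \<alpha>)" "RmbC_provable (back_fm \<alpha> \<^bold>\<rightarrow> back_fm \<psi>)"
      by simp_all
    from cpl_theory_mp[OF RmbC_theory] prem show ?thesis by blast
  next
    case (R_Box \<alpha> \<beta> i)
    with rule.IH have "RmbC_provable (back_fm \<alpha> \<^bold>\<leftrightarrow> back_fm \<beta>)" by simp
    from RmbC_congruence[OF this] R_Box show ?thesis by simp
  qed
qed

lemma back_fm_trans_fm: "RmbC_provable (back_fm (trans_fm \<phi>) \<^bold>\<leftrightarrow> \<phi>)"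
proof (induction \<phi>)
  case (Var p)
  show ?case by (rule RmbC_complete) simp
next
  case (Conj \<alpha> \<beta>)
  show ?case
  proof (rule RmbC_complete)
    fix v :: "ops fm \<Rightarrow> bool"
    assume v: "valuation v" "\<And>\<theta>. RmbC_provable \<theta> \<Longrightarrow> v \<theta>"
    from v(1) v(2)[OF Conj.IH(1)] v(2)[OF Conj.IH(2)]
    show "v (back_fm (trans_fm (\<alpha> \<^bold>\<and> \<beta>)) \<^bold>\<leftrightarrow> \<alpha> \<^bold>\<and> \<beta>)" by auto
  qed
next
  case (Disj \<alpha> \<beta>)
  show ?case
  proof (rule RmbC_complete)
    fix v :: "ops fm \<Rightarrow> bool"
    assume v: "valuation v" "\<And>\<theta>. RmbC_provable \<theta> \<Longrightarrow> v \<theta>"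
    from v(1) v(2)[OF Disj.IH(1)] v(2)[OF Disj.IH(2)]
    show "v (back_fm (trans_fm (\<alpha> \<^bold>\<or> \<beta>)) \<^bold>\<leftrightarrow> \<alpha> \<^bold>\<or> \<beta>)" by auto
  qed
next
  case (Imp \<alpha> \<beta>)
  show ?case
  proof (rule RmbC_complete)
    fix v :: "ops fm \<Rightarrow> bool"
    assume v: "valuation v" "\<And>\<theta>. RmbC_provable \<theta> \<Longrightarrow> v \<theta>"
    from v(1) v(2)[OF Imp.IH(1)] v(2)[OF Imp.IH(2)]
    show "v (back_fm (trans_fm (\<alpha> \<^bold>\<rightarrow> \<beta>)) \<^bold>\<leftrightarrow> (\<alpha> \<^bold>\<rightarrow> \<beta>))" by auto
  qed
next
  case (Unary u \<alpha>)
  show ?case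
  proof (rule RmbC_complete)
    fix v :: "ops fm \<Rightarrow> bool"
    assume v: "valuation v" "\<And>\<theta>. RmbC_provable \<theta> \<Longrightarrow> v \<theta>"
    have eq: "v (back_fm (trans_fm \<alpha>)) = v \<alpha>"
      using v(1) v(2)[OF Unary.IH] by auto
    \<comment> \<open>Unary formulas are atoms for \<open>v\<close>, so equal truth values of the
      arguments do not suffice; the provable equivalence is needed. All \<open>w\<close> are covered
      because the case of \<open>Circ\<close> involves \<open>Neg\<close> as well.\<close>
    have eq_unary: "v (Unary w (back_fm (trans_fm \<alpha>))) = v (Unary w \<alpha>)" for w
      using v(1) v(2)[OF RmbC_congruence[OF Unary.IH, of w]] by auto
    show "v (back_fm (trans_fm (Unary u \<alpha>)) \<^bold>\<leftrightarrow> Unary u \<alpha>)"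
      using v(1) eq eq_unary RmbC_valuation_Neg[OF v, of \<alpha>] RmbC_valuation_Circ[OF v, of \<alpha>]
        RmbC_valuation_falsum[OF v]
      by (cases u) auto
  qed
qed

text \<open>Faithfulness: a proof of the translation is carried back to \<open>RmbC\<close>, and the
  round trip is cancelled by the provable equivalence.\<close>

lemma provable_trans_fm_iff: "EE_provable (trans_fm \<phi>) \<longleftrightarrow> RmbC_provable \<phi>"
proof
  assume "EE_provable (trans_fm \<phi>)"
  then have prem: "RmbC_provable (back_fm (trans_fm \<phi>))" by (rule RmbC_provable_back_fm)
  show "RmbC_provable \<phi>"
  proof (rule RmbC_complete)
    fix v :: "ops fm \<Rightarrow> bool"
    assume v: "valuation v" "\<And>\<theta>. RmbC_provable \<theta> \<Longrightarrow> v \<theta>"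
    from v(1) v(2)[OF prem] v(2)[OF back_fm_trans_fm[of \<phi>]] show "v \<phi>" by simp
  qed
qed (rule EE_provable_trans_fm)

section \<open>From theorems to consequence from premises\<close>

lemma trans_fm_big_conj:
  "\<gamma>s \<noteq> [] \<Longrightarrow> trans_fm (big_conj \<gamma>s) = big_conj (map trans_fm \<gamma>s)"
  by (induction \<gamma>s rule: big_conj.induct) simp_all

text \<open>Consequence is theoremhood of an implication from a finite conjunction, and the
  translation commutes with both connectives, so the equivalence for theorems carries over.\<close>

theorem theorem5p14:
  fixes \<Gamma> :: "ops fm set" and \<phi> :: "ops fm"
  shows "\<Gamma> \<turnstile>\<^bsub>RmbC\<^esub> \<phi> \<longleftrightarrow> trans_fm ` \<Gamma> \<turnstile>\<^bsub>EE\<^esub> trans_fm \<phi>"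
proof -
  have imp: "EE_provable (big_conj (map trans_fm \<gamma>s) \<^bold>\<rightarrow> trans_fm \<phi>) \<longleftrightarrow>
      RmbC_provable (big_conj \<gamma>s \<^bold>\<rightarrow> \<phi>)" if "\<gamma>s \<noteq> []" for \<gamma>s
    using provable_trans_fm_iff[of "big_conj \<gamma>s \<^bold>\<rightarrow> \<phi>"] that by (simp add: trans_fm_big_conj)
  \<comment> \<open>A finite list of translated premises is pulled back by choosing a preimage in
    \<Gamma> for each entry.\<close>
  have lists: "set \<delta>s \<subseteq> trans_fm ` \<Gamma> \<longleftrightarrow> (\<exists>\<gamma>s. \<delta>s = map trans_fm \<gamma>s \<and> set \<gamma>s \<subseteq> \<Gamma>)" for \<delta>s
  proof -
    have "set \<delta>s \<subseteq> trans_fm ` \<Gamma> \<longleftrightarrow> \<delta>s \<in> map trans_fm ` lists \<Gamma>"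
      unfolding lists_image[symmetric] by (auto simp only: in_lists_conv_set)
    then show ?thesis by (auto simp only: lists_eq_set)
  qed
  have "(\<exists>\<delta>s. \<delta>s \<noteq> [] \<and> set \<delta>s \<subseteq> trans_fm ` \<Gamma> \<and> EE_provable (big_conj \<delta>s \<^bold>\<rightarrow> trans_fm \<phi>)) \<longleftrightarrow>
      (\<exists>\<gamma>s. \<gamma>s \<noteq> [] \<and> set \<gamma>s \<subseteq> \<Gamma> \<and> RmbC_provable (big_conj \<gamma>s \<^bold>\<rightarrow> \<phi>))"
    unfolding lists using imp by (metis map_is_Nil_conv)
  then show ?thesis
    by (simp add: entails_def provable_trans_fm_iff)
qed

end
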